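(* Let $r\geq 2$. For $\boldsymbol{n}=(n_1,\dots,n_{r-1})\in\mathbb{N}_0^{r-1}$ define \[ \Phi_{\boldsymbol{n}}(z_1,\dots,z_{r-1};q):= \prod_{i=1}^{r-1} \frac{1}{(z_iq)_{n_1-n_{i+1}}}\,{n_i \brack n_{i+1}}, \] and for $\boldsymbol{n},\boldsymbol{m}\in\mathbb{N}_0^{r-1}$ \[ \mathcal{K}_{\boldsymbol{n},\boldsymbol{m}}(z_1,\dots,z_{r-1};q):= {n_1 \brack m_1} \prod_{i=1}^{r-1} z_i^{m_i-m_{i+1}} q^{m_i^2-m_im_{i+1}} {n_1-n_{i+1}-m_1+m_i \brack n_i-n_{i+1}}, \] where $n_r=m_r:=0$. Then for every $\boldsymbol{n}\in\mathbb{N}_0^{r-1}$, \[ \sum_{\boldsymbol{m}\in\mathbb{N}_0^{r-1}} \mathcal{K}_{\boldsymbol{n},\boldsymbol{m}}(z_1,\dots,z_{r-1};q) \Phi_{\boldsymbol{m}}(z_1,\dots,z_{r-1};q) =\Phi_{\boldsymbol{n}}(z_1,\dots,z_{r-1};q). \]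
   Context: For $n\in\mathbb{Z}$, $(x)_n=(x;q)_n:=(x;q)_\infty/(xq^n;q)_\infty$ with $(x;q)_\infty=\prod_{i\ge0}(1-xq^i)$. For $n,m\in\mathbb{Z}$, ${n\brack m}=\frac{(q)_n}{(q)_m(q)_{n-m}}$ if $0\leq m\leq n$ and $0$ otherwise, with $(q)_n=(q;q)_n$. *)

theory Defs
  imports "HOL-Analysis.Analysis"
begin

text \<open>\<open>(x;q)\<^sub>\<infinity>\<close>, for \<open>norm q < 1\<close>.  The library's \<^const>\<open>prodinf\<close> admits vanishing factors,
  in which case its value is \<open>0\<close>.\<close>

definition qpoch_inf :: "complex \<Rightarrow> complex \<Rightarrow> complex" where
  "qpoch_inf x q = (\<Prod>i. 1 - x * q ^ i)"

definition qpoch :: "complex \<Rightarrow> complex \<Rightarrow> int \<Rightarrow> complex" where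
  "qpoch x q n = qpoch_inf x q / qpoch_inf (x * q powi n) q"

definition qbinom :: "complex \<Rightarrow> int \<Rightarrow> int \<Rightarrow> complex" where
  "qbinom q n m =
     (if 0 \<le> m \<and> m \<le> n then qpoch q q n / (qpoch q q m * qpoch q q (n - m)) else 0)"

text \<open>A vector in \<open>\<nat>\<^sub>0\<^sup>r\<^sup>-\<^sup>1\<close> is a function with entries at \<open>1, \<dots>, r - 1\<close> and value \<open>0\<close> elsewhere.
  This makes the vectors unique as functions (so that sums over them count each one once) and
  includes the convention that the entry at \<open>r\<close> is \<open>0\<close>.\<close>

definition nat_vecs :: "nat \<Rightarrow> (nat \<Rightarrow> nat) set" where
  "nat_vecs r = {n. \<forall>i. i \<notin> {1..r - 1} \<longrightarrow> n i = 0}"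

text \<open>All differences of entries below are taken in the integers, since they may be negative.
  If \<open>n i < n (i + 1)\<close> for some \<open>i \<in> {1..r - 1}\<close>, then \<^term>\<open>qbinom\<close> makes \<open>\<Phi>\<close> vanish.\<close>

definition Phi :: "nat \<Rightarrow> (nat \<Rightarrow> complex) \<Rightarrow> complex \<Rightarrow> (nat \<Rightarrow> nat) \<Rightarrow> complex" where
  "Phi r z q n =
     (\<Prod>i = 1..r - 1.
        1 / qpoch (z i * q) q (int (n 1) - int (n (i + 1)))
        * qbinom q (int (n i)) (int (n (i + 1))))"

definition Kernel ::
  "nat \<Rightarrow> (nat \<Rightarrow> complex) \<Rightarrow> complex \<Rightarrow> (nat \<Rightarrow> nat) \<Rightarrow> (nat \<Rightarrow> nat) \<Rightarrow> complex" where
  "Kernel r z q n m =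
     qbinom q (int (n 1)) (int (m 1)) *
     (\<Prod>i = 1..r - 1.
        z i powi (int (m i) - int (m (i + 1)))
        * q powi (int (m i) ^ 2 - int (m i) * int (m (i + 1)))
        * qbinom q (int (n 1) - int (n (i + 1)) - int (m 1) + int (m i))
                   (int (n i) - int (n (i + 1))))"

end

theory Submission
  imports Defs
begin

text \<open>Put \<open>s = r - 1\<close>, \<open>a\<^sub>i = n\<^sub>1 - n\<^sub>i\<^sub>+\<^sub>1\<close> and \<open>b\<^sub>i = m\<^sub>1 - m\<^sub>i\<^sub>+\<^sub>1\<close>.  Only chains
  \<open>0 = b\<^sub>0 \<le> b\<^sub>1 \<le> \<dots> \<le> b\<^sub>s\<close> with \<open>b\<^sub>i \<le> a\<^sub>i\<close> contribute, and the exponent of \<open>q\<close>, which is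
  the sum of \<open>(b\<^sub>s - b\<^sub>i\<^sub>-\<^sub>1)(b\<^sub>i - b\<^sub>i\<^sub>-\<^sub>1)\<close>, equals the sum of \<open>b\<^sub>i (b\<^sub>i - b\<^sub>i\<^sub>-\<^sub>1)\<close>.  After
  cancelling factors that depend on \<open>a\<close> only, the claim becomes
  \[ \sum_b \prod_{i=1}^s z_i^{b_i-b_{i-1}} q^{b_i(b_i-b_{i-1})}
      {a_i-b_{i-1} \brack b_i-b_{i-1}} \frac{1}{(z_iq)_{b_i}} = \prod_{i=1}^s \frac{1}{(z_iq)_{a_i}}. \]
  By a finite form of Cauchy's identity the sum over \<open>b\<^sub>s\<close> is \<open>1/(z\<^sub>sq)\<^bsub>a\<^sub>s\<^esub>\<close>, whatever
  \<open>b\<^sub>s\<^sub>-\<^sub>1\<close> is; hence the multiple sum factors.\<close>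

section \<open>Finite q-Pochhammer symbols and Gaussian binomials\<close>

definition qpoch_fin :: "complex \<Rightarrow> complex \<Rightarrow> nat \<Rightarrow> complex" where
  "qpoch_fin x q k = (\<Prod>i<k. 1 - x * q ^ i)"

definition gauss_binom :: "complex \<Rightarrow> nat \<Rightarrow> nat \<Rightarrow> complex" where
  "gauss_binom q n k =
     (if k \<le> n then qpoch_fin q q n / (qpoch_fin q q k * qpoch_fin q q (n - k)) else 0)"

lemma qpoch_fin_0 [simp]: "qpoch_fin x q 0 = 1"
  by (simp add: qpoch_fin_def)

lemma qpoch_fin_Suc: "qpoch_fin x q (Suc k) = qpoch_fin x q k * (1 - x * q ^ k)"
  by (simp add: qpoch_fin_def)

lemma qpoch_fin_Suc_shift: "qpoch_fin x q (Suc k) = (1 - x) * qpoch_fin (x * q) q k"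
  by (simp add: qpoch_fin_def prod.lessThan_Suc_shift mult.assoc del: prod.lessThan_Suc)

lemma qpoch_fin_add: "qpoch_fin x q (k + l) = qpoch_fin x q k * qpoch_fin (x * q ^ k) q l"
  by (induction l) (simp_all add: qpoch_fin_Suc power_add mult.assoc)

lemma one_minus_power_nonzero:
  fixes q :: complex
  assumes "norm q < 1" "k \<ge> 1"
  shows "1 - q ^ k \<noteq> 0"
proof
  assume "1 - q ^ k = 0"
  then have "norm q ^ k = 1"
    by (metis eq_iff_diff_eq_0 norm_one norm_power)
  moreover have "norm q ^ k < 1"
    using assms by (simp add: power_less_one_iff)
  ultimately show False by simp
qed

lemma qpoch_fin_q_nonzero: "norm q < 1 \<Longrightarrow> qpoch_fin q q k \<noteq> 0"
  using one_minus_power_nonzero[of q "Suc _"] by (auto simp: qpoch_fin_def)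

lemma convergent_prod_qpoch:
  fixes x q :: complex
  assumes "norm q < 1"
  shows "convergent_prod (\<lambda>i. 1 - x * q ^ i)"
proof -
  have "summable (\<lambda>i. norm (1 - x * q ^ i - 1))"
    using assms by (simp add: norm_mult norm_power summable_mult summable_geometric)
  then show ?thesis
    by (intro abs_convergent_prod_imp_convergent_prod summable_imp_abs_convergent_prod)
qed

text \<open>Splitting off the first \<open>k\<close> factors of the convergent infinite product
  leaves the tail that stands in the denominator. No factor vanishes, so the tail is nonzero and
  cancels.\<close>

lemma qpoch_of_nat:
  assumes "norm q < 1" and nz: "\<And>i. x * q ^ i \<noteq> 1"
  shows "qpoch x q (int k) = qpoch_fin x q k"
proof -
  have nz': "1 - x * q ^ i \<noteq> 0" for i
    using nz[of i] by simp
  have "qpoch_inf x q = qpoch_inf (x * q ^ k) q * qpoch_fin x q k"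
    using prodinf_split_initial_segment[OF convergent_prod_qpoch[OF assms(1), of x] nz', of k]
    by (simp add: qpoch_inf_def qpoch_fin_def power_add ac_simps)
  moreover have "qpoch_inf (x * q ^ k) q \<noteq> 0"
    unfolding qpoch_inf_def
  proof (rule prodinf_nonzero)
    show "convergent_prod (\<lambda>i. 1 - x * q ^ k * q ^ i)"
      by (rule convergent_prod_qpoch[OF assms(1)])
    show "1 - x * q ^ k * q ^ i \<noteq> 0" for i
      using nz'[of "k + i"] by (simp add: power_add mult.assoc)
  qed
  ultimately show ?thesis
    by (simp add: qpoch_def)
qed

lemma qbinom_of_nat:
  assumes "norm q < 1"
  shows "qbinom q (int n) (int k) = gauss_binom q n k"
proof -
  have "q * q ^ i \<noteq> 1" for i
    using one_minus_power_nonzero[OF assms, of "Suc i"] by simp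
  then have *: "qpoch q q (int j) = qpoch_fin q q j" for j
    by (rule qpoch_of_nat[OF assms])
  show ?thesis
    by (auto simp: qbinom_def gauss_binom_def * simp flip: of_nat_diff)
qed

lemma gauss_binom_0_right: "norm q < 1 \<Longrightarrow> gauss_binom q n 0 = 1"
  by (simp add: gauss_binom_def qpoch_fin_q_nonzero)

text \<open>For k < n, clearing denominators leaves 1 - q^(n+1) = q^(k+1) (1 - q^(n-k)) + (1 -
  q^(k+1)). The boundary cases rest on the value 0 outside the range.\<close>

lemma gauss_binom_Suc_Suc:
  assumes "norm q < 1"
  shows "gauss_binom q (Suc n) (Suc k) = q ^ Suc k * gauss_binom q n (Suc k) + gauss_binom q n k"
proof -
  note nz = qpoch_fin_q_nonzero[OF assms]
  consider "n < k" | "n = k" | "k < n" by linarith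
  then show ?thesis
  proof cases
    case 3
    then obtain d where d: "n = k + Suc d"
      using less_iff_Suc_add by auto
    define A B C where "A = qpoch_fin q q k" and "B = qpoch_fin q q d" and "C = qpoch_fin q q n"
    have nz': "A \<noteq> 0" "B \<noteq> 0" "1 - q * q ^ k \<noteq> 0" "1 - q * q ^ d \<noteq> 0"
      using nz one_minus_power_nonzero[OF assms, of "Suc _"] by (auto simp: A_def B_def)
    have 1: "gauss_binom q (Suc n) (Suc k)
        = C * (1 - q * q ^ n) / (A * (1 - q * q ^ k) * (B * (1 - q * q ^ d)))"
      by (simp add: gauss_binom_def d qpoch_fin_Suc A_def B_def C_def)
    have 2: "gauss_binom q n (Suc k) = C / (A * (1 - q * q ^ k) * B)"
      by (simp add: gauss_binom_def d qpoch_fin_Suc A_def B_def C_def)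
    have 3: "gauss_binom q n k = C / (A * (B * (1 - q * q ^ d)))"
      by (simp add: gauss_binom_def d qpoch_fin_Suc A_def B_def C_def)
    have 4: "q ^ n = q ^ k * q * q ^ d"
      by (simp add: d power_add)
    show ?thesis
      unfolding 1 2 3 4 using nz' by (simp add: divide_simps) (simp add: algebra_simps)
  qed (use nz in \<open>auto simp: gauss_binom_def\<close>)
qed

section \<open>A finite form of Cauchy's identity\<close>

text \<open>Induction on \<open>N\<close> for all \<open>w\<close> at once: the q-Pascal rule turns
  the sum for N+1 at w into the sum for N at wq, divided by 1 - wq.\<close>

lemma finite_Cauchy_identity:
  assumes "norm q < 1" and "\<And>k. k \<ge> 1 \<Longrightarrow> w * q ^ k \<noteq> 1"
  shows "(\<Sum>k\<le>N. gauss_binom q N k * w ^ k * q ^ (k * k) / qpoch_fin (w * q) q k)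
           = 1 / qpoch_fin (w * q) q N"
  using assms(2)
proof (induction N arbitrary: w)
  case 0
  then show ?case using assms by (simp add: gauss_binom_0_right)
next
  case (Suc N)
  have nz: "1 - w * q * q ^ k \<noteq> 0" for k
    using Suc.prems[of "Suc k"] by (simp add: mult.assoc)
  have nz': "1 - w * q \<noteq> 0"
    using nz[of 0] by simp
  have nz2: "qpoch_fin (w * q * q) q k \<noteq> 0" for k
    using nz[of "Suc _"] by (auto simp: qpoch_fin_def mult.assoc)
  let ?g = "gauss_binom q"
  let ?P = "qpoch_fin (w * q) q"
  let ?P' = "qpoch_fin (w * q * q) q"
  have IH: "(\<Sum>k\<le>N. ?g N k * (w * q) ^ k * q ^ (k * k) / ?P' k) = 1 / ?P' N"
    by (rule Suc.IH) (use Suc.prems[of "Suc _"] in \<open>simp add: mult.assoc\<close>)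
  \<comment> \<open>Split off the last or the first factor of (wq)_(k+1) and compare.\<close>
  have P1: "?P k = (1 - w * q) * ?P' k / (1 - w * q * q ^ k)" for k
    using qpoch_fin_Suc[of "w * q" q k] qpoch_fin_Suc_shift[of "w * q" q k] nz[of k]
    by (simp add: divide_simps)
  have P2: "?P (Suc k) = (1 - w * q) * ?P' k" for k
    by (rule qpoch_fin_Suc_shift)
  \<comment> \<open>By the q-Pascal rule the term k+1 of the sum for N+1 is
    \<open>u (Suc k) + v k\<close>. The shift of index in \<open>v\<close> lets \<open>u k\<close>
    and \<open>v k\<close> be paired afterwards.\<close>
  define u where "u k = ?g N k * q ^ k * w ^ k * q ^ (k * k) / ?P k" for k
  define v where "v k = ?g N k * w ^ Suc k * q ^ (Suc k * Suc k) / ?P (Suc k)" for k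
  have "u (Suc N) = 0"
    by (simp add: u_def gauss_binom_def)
  have "(\<Sum>k\<le>Suc N. ?g (Suc N) k * w ^ k * q ^ (k * k) / ?P k)
      = u 0 + (\<Sum>k\<le>N. u (Suc k) + v k)"
    unfolding sum.atMost_Suc_shift
    by (simp add: u_def v_def gauss_binom_0_right[OF assms(1)] gauss_binom_Suc_Suc[OF assms(1)]
        algebra_simps add_divide_distrib)
  also have "\<dots> = (\<Sum>k\<le>Suc N. u k) + (\<Sum>k\<le>N. v k)"
    unfolding sum.atMost_Suc_shift by (simp add: sum.distrib)
  also have "\<dots> = (\<Sum>k\<le>N. u k + v k)"
    using \<open>u (Suc N) = 0\<close> by (simp add: sum.distrib)
  also have "\<dots> = (\<Sum>k\<le>N. ?g N k * (w * q) ^ k * q ^ (k * k) / ?P' k / (1 - w * q))"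
  proof (rule sum.cong)
    fix k
    \<comment> \<open>Relative to the term k of the sum at wq, divided by 1 - wq, \<open>v k\<close>
      has weight w q^(k+1) and \<open>u k\<close> has weight 1 - w q^(k+1); the weights add up to
      1.\<close>
    have v: "v k = ?g N k * (w * q) ^ k * q ^ (k * k) * (w * q * q ^ k) / ?P' k / (1 - w * q)"
      unfolding v_def P2 by (simp add: power_add power_mult_distrib ac_simps)
    have u: "u k = ?g N k * (w * q) ^ k * q ^ (k * k) * (1 - w * q * q ^ k) / ?P' k / (1 - w * q)"
      unfolding u_def P1 by (simp add: power_mult_distrib ac_simps)
    show "u k + v k = ?g N k * (w * q) ^ k * q ^ (k * k) / ?P' k / (1 - w * q)"
      unfolding u v by (simp add: algebra_simps flip: add_divide_distrib)
  qed simp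
  also have "\<dots> = 1 / ?P (Suc N)"
    unfolding P2 sum_divide_distrib[symmetric] IH by simp
  finally show ?case .
qed

text \<open>With y = x + k the factor q^(xk) is absorbed into w^k, and (wq)_x splits off from every
  denominator; the previous identity then applies at w q^x. The point is that the value does not
  depend on \<open>x\<close>.\<close>

lemma finite_Cauchy_identity_shifted:
  assumes "norm q < 1" and nz: "\<And>k. k \<ge> 1 \<Longrightarrow> w * q ^ k \<noteq> 1" and "x \<le> a"
  shows "(\<Sum>y\<in>{x..a}. w ^ (y - x) * q ^ (y * (y - x)) * gauss_binom q (a - x) (y - x)
            / qpoch_fin (w * q) q y) = 1 / qpoch_fin (w * q) q a"
proof -
  have P: "qpoch_fin (w * q) q (x + k) = qpoch_fin (w * q) q x * qpoch_fin (w * q ^ x * q) q k" for k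
    by (simp add: qpoch_fin_add mult.assoc mult.commute[of q])
  have "(\<Sum>y\<in>{x..a}. w ^ (y - x) * q ^ (y * (y - x)) * gauss_binom q (a - x) (y - x)
            / qpoch_fin (w * q) q y)
      = (\<Sum>k\<le>a - x. w ^ k * q ^ ((x + k) * k) * gauss_binom q (a - x) k
            / qpoch_fin (w * q) q (x + k))"
    by (rule sum.reindex_bij_witness[of _ "\<lambda>k. x + k" "\<lambda>y. y - x"]) (use \<open>x \<le> a\<close> in auto)
  also have "\<dots> = (\<Sum>k\<le>a - x. gauss_binom q (a - x) k * (w * q ^ x) ^ k * q ^ (k * k)
            / qpoch_fin (w * q ^ x * q) q k) / qpoch_fin (w * q) q x"
    unfolding P sum_divide_distrib
    by (intro sum.cong refl)
      (simp add: power_mult_distrib power_add add_mult_distrib add_mult_distrib2 ac_simps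
        flip: power_mult)
  also have "(\<Sum>k\<le>a - x. gauss_binom q (a - x) k * (w * q ^ x) ^ k * q ^ (k * k)
            / qpoch_fin (w * q ^ x * q) q k) = 1 / qpoch_fin (w * q ^ x * q) q (a - x)"
    by (rule finite_Cauchy_identity[OF assms(1)])
      (use nz[of "x + _"] in \<open>simp add: power_add mult.assoc\<close>)
  also have "\<dots> / qpoch_fin (w * q) q x = 1 / qpoch_fin (w * q) q a"
    using P[of "a - x"] \<open>x \<le> a\<close> by (simp add: mult.commute)
  finally show ?thesis .
qed

section \<open>Factoring sums over bounded chains\<close>

text \<open>The value 0 beyond \<open>s\<close> makes each finite chain a single function, so that
  the set is finite and sums count each chain once.\<close>

definition bounded_chains :: "(nat \<Rightarrow> nat) \<Rightarrow> nat \<Rightarrow> (nat \<Rightarrow> nat) set" where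
  "bounded_chains a s = {b. b 0 = 0 \<and> (\<forall>i<s. b i \<le> b (Suc i)) \<and> (\<forall>i\<le>s. b i \<le> a i) \<and> (\<forall>i>s. b i = 0)}"

lemma bounded_chains_Suc:
  "bij_betw (\<lambda>(b, y). b(Suc s := y))
     (Sigma (bounded_chains a s) (\<lambda>b. {b s..a (Suc s)})) (bounded_chains a (Suc s))"
  \<comment> \<open>The inverse resets the entry at \<open>Suc s\<close> to the padding value
    0.\<close>
  by (rule bij_betw_byWitness[where f' = "\<lambda>b. (b(Suc s := 0), b (Suc s))"])
    (auto simp: bounded_chains_def less_Suc_eq le_Suc_eq fun_eq_iff)

lemma bounded_chains_0: "bounded_chains a 0 = {\<lambda>_. 0}"
  by (auto simp: bounded_chains_def fun_eq_iff) (metis neq0_conv)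

lemma finite_bounded_chains: "finite (bounded_chains a s)"
  by (induction s) (auto simp: bounded_chains_0 simp flip: bij_betw_finite[OF bounded_chains_Suc])

text \<open>The sum over the last entry has the same value for every preceding entry, so it leaves
  the sum as a constant; induction removes the entries from the top down.\<close>

lemma sum_bounded_chains_factor:
  fixes f :: "nat \<Rightarrow> nat \<Rightarrow> nat \<Rightarrow> 'a :: comm_semiring_1"
  assumes "\<And>i x. i < s \<Longrightarrow> x \<le> a i \<Longrightarrow> (\<Sum>y\<in>{x..a (Suc i)}. f i x y) = g i"
  shows "(\<Sum>b\<in>bounded_chains a s. \<Prod>i<s. f i (b i) (b (Suc i))) = (\<Prod>i<s. g i)"
  using assms
proof (induction s)
  case 0
  then show ?case by (simp add: bounded_chains_0)
next
  case (Suc s)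
  have "(\<Sum>b\<in>bounded_chains a (Suc s). \<Prod>i<Suc s. f i (b i) (b (Suc i)))
      = (\<Sum>(b, y)\<in>Sigma (bounded_chains a s) (\<lambda>b. {b s..a (Suc s)}).
           (\<Prod>i<s. f i (b i) (b (Suc i))) * f s (b s) y)"
    unfolding sum.reindex_bij_betw[OF bounded_chains_Suc, symmetric]
    by (intro sum.cong refl) (auto intro!: arg_cong2[where f = "(*)"] prod.cong)
  also have "\<dots> = (\<Sum>b\<in>bounded_chains a s. (\<Prod>i<s. f i (b i) (b (Suc i))) * (\<Sum>y\<in>{b s..a (Suc s)}. f s (b s) y))"
    by (simp add: finite_bounded_chains sum_distrib_left flip: sum.Sigma)
  also have "\<dots> = (\<Sum>b\<in>bounded_chains a s. (\<Prod>i<s. f i (b i) (b (Suc i))) * g s)"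
    by (intro sum.cong refl) (use Suc.prems in \<open>auto simp: bounded_chains_def\<close>)
  also have "\<dots> = (\<Prod>i<Suc s. g i)"
    using Suc by (simp flip: sum_distrib_right)
  finally show ?case .
qed

section \<open>Kernel and \<Phi> in chain coordinates\<close>

text \<open>The difference of the two sides telescopes to b_s^2 - b_s b_s.\<close>

lemma sum_chain_exponents:
  fixes b :: "nat \<Rightarrow> int"
  assumes "b 0 = 0"
  shows "(\<Sum>i<s. (b s - b i) * (b (Suc i) - b i)) = (\<Sum>i<s. b (Suc i) * (b (Suc i) - b i))"
proof -
  have "(\<Sum>i<s. b (Suc i) * (b (Suc i) - b i)) - (\<Sum>i<s. (b s - b i) * (b (Suc i) - b i))
      = (\<Sum>i<s. b (Suc i) ^ 2 - b i ^ 2) - b s * (\<Sum>i<s. b (Suc i) - b i)"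
    unfolding sum_distrib_left sum_subtractf[symmetric]
    by (intro sum.cong refl) (simp add: algebra_simps power2_eq_square)
  also have "\<dots> = 0"
    using assms by (simp add: sum_lessThan_telescope[of b] sum_lessThan_telescope[of "\<lambda>i. b i ^ 2"])
      (simp add: power2_eq_square)
  finally show ?thesis by simp
qed

text \<open>This inverts b_i = m_1 - m_(i+1): the convention m_(s+1) = 0 gives m_1 = b_s, hence m_i
  = b_s - b_(i-1).\<close>

definition vec_of_chain :: "nat \<Rightarrow> (nat \<Rightarrow> nat) \<Rightarrow> nat \<Rightarrow> nat" where
  "vec_of_chain s b = (\<lambda>i. if i \<in> {1..s} then b s - b (i - 1) else 0)"

text \<open>The case i = s also holds, as the default value 0 agrees with
  \<open>b s - b s\<close>.\<close>

lemma vec_of_chain_Suc: "i \<le> s \<Longrightarrow> vec_of_chain s b (Suc i) = b s - b i"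
  by (cases "i = s") (auto simp: vec_of_chain_def)

lemma chain_le:
  fixes b :: "nat \<Rightarrow> nat"
  assumes "\<forall>i<s. b i \<le> b (Suc i)" "i \<le> j" "j \<le> s"
  shows "b i \<le> b j"
  using assms(2,3) by (induction rule: dec_induct) (use assms(1) in \<open>auto intro: order_trans\<close>)

lemma Phi_vec_of_chain:
  assumes "norm q < 1" and nz: "\<forall>i\<in>{1..s}. \<forall>k\<ge>1. z i * q ^ k \<noteq> 1"
    and "b 0 = 0" and mono: "\<forall>i<s. b i \<le> b (Suc i)"
  shows "Phi (Suc s) z q (vec_of_chain s b) =
     (\<Prod>i<s. 1 / qpoch_fin (z (Suc i) * q) q (b (Suc i))
        * gauss_binom q (b s - b i) (b s - b (Suc i)))"
proof -
  have "qpoch (z (Suc i) * q) q (int (vec_of_chain s b 1) - int (vec_of_chain s b (Suc (Suc i))))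
      = qpoch_fin (z (Suc i) * q) q (b (Suc i))" if "i < s" for i
  proof -
    have "qpoch (z (Suc i) * q) q (int (b (Suc i))) = qpoch_fin (z (Suc i) * q) q (b (Suc i))"
      by (rule qpoch_of_nat[OF assms(1)]) (use that nz in \<open>auto simp: mult.assoc simp flip: power_Suc\<close>)
    moreover have "b (Suc i) \<le> b s"
      using chain_le[OF mono, of "Suc i" s] that by simp
    ultimately show ?thesis
      using that assms(3) vec_of_chain_Suc[of 0 s b] vec_of_chain_Suc[of "Suc i" s b]
      by (simp add: of_nat_diff)
  qed
  then show ?thesis
    unfolding Phi_def
    by (simp add: prod.atLeast1_atMost_eq vec_of_chain_Suc qbinom_of_nat[OF assms(1)])
qed

text \<open>Monotonicity and b_i \<le> a_i make every integer difference nonnegative, so integer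
  powers and indices become natural numbers. The exponent of q is m_i (m_i - m_(i+1)).\<close>

lemma Kernel_vec_of_chain:
  assumes "norm q < 1" and "a 0 = 0" and mono: "\<forall>i<s. a i \<le> a (Suc i)"
    and b: "b \<in> bounded_chains a s"
  shows "Kernel (Suc s) z q (vec_of_chain s a) (vec_of_chain s b) =
     gauss_binom q (a s) (b s) *
     (\<Prod>i<s. z (Suc i) ^ (b (Suc i) - b i) * q ^ ((b s - b i) * (b (Suc i) - b i))
        * gauss_binom q (a (Suc i) - b i) (a (Suc i) - a i))"
proof -
  have b0: "b 0 = 0" and monob: "\<forall>i<s. b i \<le> b (Suc i)" and le: "\<forall>i\<le>s. b i \<le> a i"
    using b by (auto simp: bounded_chains_def)
  let ?n = "vec_of_chain s a" and ?m = "vec_of_chain s b"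
  have one: "?n 1 = a s" "?m 1 = b s"
    using vec_of_chain_Suc[of 0 s] \<open>a 0 = 0\<close> b0 by auto
  have factor: "z (Suc i) powi (int (?m (Suc i)) - int (?m (Suc i + 1)))
        * q powi (int (?m (Suc i)) ^ 2 - int (?m (Suc i)) * int (?m (Suc i + 1)))
        * qbinom q (int (a s) - int (?n (Suc i + 1)) - int (b s) + int (?m (Suc i)))
                   (int (?n (Suc i)) - int (?n (Suc i + 1)))
      = z (Suc i) ^ (b (Suc i) - b i) * q ^ ((b s - b i) * (b (Suc i) - b i))
        * gauss_binom q (a (Suc i) - b i) (a (Suc i) - a i)" if "i < s" for i
  proof -
    have ineqs: "b i \<le> b (Suc i)" "b (Suc i) \<le> b s" "a i \<le> a (Suc i)" "a (Suc i) \<le> a s" "b i \<le> a i"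
      using that monob mono le chain_le[OF monob, of "Suc i" s] chain_le[OF mono, of "Suc i" s]
      by auto
    have m: "?m (Suc i) = b s - b i" "?m (Suc i + 1) = b s - b (Suc i)"
      and n: "?n (Suc i) = a s - a i" "?n (Suc i + 1) = a s - a (Suc i)"
      using that by (auto simp: vec_of_chain_Suc)
    have 1: "int (?m (Suc i)) - int (?m (Suc i + 1)) = int (b (Suc i) - b i)"
      unfolding m using ineqs by (simp add: of_nat_diff)
    have 2: "int (?m (Suc i)) ^ 2 - int (?m (Suc i)) * int (?m (Suc i + 1))
        = int ((b s - b i) * (b (Suc i) - b i))"
      unfolding m of_nat_mult using ineqs
      by (simp add: of_nat_diff power2_eq_square) (simp add: algebra_simps)
    have 3: "int (a s) - int (?n (Suc i + 1)) - int (b s) + int (?m (Suc i))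
        = int (a (Suc i) - b i)"
      unfolding m n using ineqs by (simp add: of_nat_diff)
    have 4: "int (?n (Suc i)) - int (?n (Suc i + 1)) = int (a (Suc i) - a i)"
      unfolding n using ineqs by (simp add: of_nat_diff)
    show ?thesis
      unfolding 1 2 3 4 by (simp only: power_int_of_nat qbinom_of_nat[OF assms(1)])
  qed
  show ?thesis
    unfolding Kernel_def one qbinom_of_nat[OF assms(1)] diff_Suc_1
      prod.atLeast1_atMost_eq[folded One_nat_def]
    by (rule arg_cong2[where f = "(*)"], rule refl, rule prod.cong[OF refl], rule factor) simp
qed

text \<open>The quotients (q)_(b_s - b_i) / (q)_(b_s - b_(i+1)) telescope; what results is the
  q-multinomial coefficient of the increments of \<open>b\<close>.\<close>

lemma prod_gauss_binom_chain:
  assumes "norm q < 1" and "b 0 = 0" and mono: "\<forall>i<s. b i \<le> b (Suc i)"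
  shows "(\<Prod>i<s. gauss_binom q (b s - b i) (b s - b (Suc i)))
           = qpoch_fin q q (b s) * (\<Prod>i<s. 1 / qpoch_fin q q (b (Suc i) - b i))"
proof -
  let ?Q = "qpoch_fin q q"
  have "(\<Prod>i<s. gauss_binom q (b s - b i) (b s - b (Suc i)))
      = (\<Prod>i<s. ?Q (b s - b i) / ?Q (b s - b (Suc i)) * (1 / ?Q (b (Suc i) - b i)))"
  proof (rule prod.cong)
    fix i assume "i \<in> {..<s}"
    then have "b i \<le> b (Suc i)" "b (Suc i) \<le> b s"
      using mono chain_le[OF mono, of "Suc i" s] by auto
    then show "gauss_binom q (b s - b i) (b s - b (Suc i))
        = ?Q (b s - b i) / ?Q (b s - b (Suc i)) * (1 / ?Q (b (Suc i) - b i))"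
      by (simp add: gauss_binom_def)
  qed simp
  also have "\<dots> = ?Q (b s) * (\<Prod>i<s. 1 / ?Q (b (Suc i) - b i))"
    unfolding prod.distrib
    using prod_lessThan_telescope'[of s "\<lambda>i. ?Q (b s - b i)"] assms(2)
    by (simp add: qpoch_fin_q_nonzero[OF assms(1)])
  finally show ?thesis .
qed

section \<open>Separating and summing the terms\<close>

text \<open>Apart from a constant depending on \<open>a\<close> only, each factor on the right links
  just b_i and b_(i+1). This is the form that \<open>sum_bounded_chains_factor\<close>
  requires.\<close>

lemma summand_vec_of_chain:
  assumes q: "norm q < 1" and nz: "\<forall>i\<in>{1..s}. \<forall>k\<ge>1. z i * q ^ k \<noteq> 1"
    and a0: "a 0 = 0" and monoa: "\<forall>i<s. a i \<le> a (Suc i)" and b: "b \<in> bounded_chains a s"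
  shows "Kernel (Suc s) z q (vec_of_chain s a) (vec_of_chain s b) * Phi (Suc s) z q (vec_of_chain s b)
      = qpoch_fin q q (a s) * (\<Prod>i<s. 1 / qpoch_fin q q (a (Suc i) - a i))
        * (\<Prod>i<s. z (Suc i) ^ (b (Suc i) - b i) * q ^ (b (Suc i) * (b (Suc i) - b i))
            * gauss_binom q (a (Suc i) - b i) (b (Suc i) - b i)
            / qpoch_fin (z (Suc i) * q) q (b (Suc i)))"
proof -
  have b0: "b 0 = 0" and monob: "\<forall>i<s. b i \<le> b (Suc i)" and le: "\<forall>i\<le>s. b i \<le> a i"
    using b by (auto simp: bounded_chains_def)
  let ?Q = "qpoch_fin q q"
  note Qnz = qpoch_fin_q_nonzero[OF q]
  define Z where "Z = (\<lambda>i. z (Suc i) ^ (b (Suc i) - b i))"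
  define P where "P = (\<lambda>i. 1 / qpoch_fin (z (Suc i) * q) q (b (Suc i)))"
  \<comment> \<open>The exponents on the left involve b_s in every factor; those on the right are
    local.\<close>
  have q_prod: "(\<Prod>i<s. q ^ ((b s - b i) * (b (Suc i) - b i)))
      = (\<Prod>i<s. q ^ (b (Suc i) * (b (Suc i) - b i)))"
  proof -
    have "int (\<Sum>i<s. (b s - b i) * (b (Suc i) - b i)) = (\<Sum>i<s. (int (b s) - int (b i)) * (int (b (Suc i)) - int (b i)))"
      unfolding of_nat_sum
      by (intro sum.cong refl) (use monob chain_le[OF monob, of _ s] in \<open>simp add: of_nat_diff\<close>)
    also have "\<dots> = (\<Sum>i<s. int (b (Suc i)) * (int (b (Suc i)) - int (b i)))"
      using sum_chain_exponents[of "\<lambda>i. int (b i)" s] b0 by simp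
    also have "\<dots> = int (\<Sum>i<s. b (Suc i) * (b (Suc i) - b i))"
      unfolding of_nat_sum
      by (intro sum.cong refl) (use monob in \<open>simp add: of_nat_diff\<close>)
    finally have "(\<Sum>i<s. (b s - b i) * (b (Suc i) - b i)) = (\<Sum>i<s. b (Suc i) * (b (Suc i) - b i))"
      by (simp only: of_nat_eq_iff)
    then show ?thesis
      by (simp only: power_sum[symmetric])
  qed
  \<comment> \<open>Expanding in q-factorials exchanges the lower index a_(i+1) - a_i for b_(i+1) -
    b_i. The ratios of (q)_(a_i - b_i) left over telescope to (q)_(a_s - b_s).\<close>
  have "(\<Prod>i<s. gauss_binom q (a (Suc i) - b i) (a (Suc i) - a i) * (1 / ?Q (b (Suc i) - b i)))
      = (\<Prod>i<s. ?Q (a (Suc i) - b (Suc i)) / ?Q (a i - b i) * (1 / ?Q (a (Suc i) - a i))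
          * gauss_binom q (a (Suc i) - b i) (b (Suc i) - b i))"
  proof (rule prod.cong)
    fix i assume "i \<in> {..<s}"
    then have "a i \<le> a (Suc i)" "b i \<le> b (Suc i)" "b i \<le> a i" "b (Suc i) \<le> a (Suc i)"
      using monoa monob le by auto
    then show "gauss_binom q (a (Suc i) - b i) (a (Suc i) - a i) * (1 / ?Q (b (Suc i) - b i))
      = ?Q (a (Suc i) - b (Suc i)) / ?Q (a i - b i) * (1 / ?Q (a (Suc i) - a i))
          * gauss_binom q (a (Suc i) - b i) (b (Suc i) - b i)"
      using Qnz by (simp add: gauss_binom_def diff_le_mono diff_le_mono2)
  qed simp
  also have "\<dots> = ?Q (a s - b s) * (\<Prod>i<s. 1 / ?Q (a (Suc i) - a i))
      * (\<Prod>i<s. gauss_binom q (a (Suc i) - b i) (b (Suc i) - b i))"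
    unfolding prod.distrib
    using prod_lessThan_telescope[of s "\<lambda>i. ?Q (a i - b i)"] Qnz a0 by simp
  finally have binoms: "(\<Prod>i<s. gauss_binom q (a (Suc i) - b i) (a (Suc i) - a i))
        * (\<Prod>i<s. 1 / ?Q (b (Suc i) - b i))
      = ?Q (a s - b s) * (\<Prod>i<s. 1 / ?Q (a (Suc i) - a i))
        * (\<Prod>i<s. gauss_binom q (a (Suc i) - b i) (b (Suc i) - b i))"
    by (simp only: prod.distrib)
  \<comment> \<open>The head binomial absorbs (q)_(b_s) from \<Phi> and (q)_(a_s - b_s) from the
    telescoping, which removes the last dependence on b_s alone.\<close>
  have outer: "gauss_binom q (a s) (b s) * ?Q (b s) * ?Q (a s - b s) = ?Q (a s)"
    using le Qnz by (simp add: gauss_binom_def)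
  have "Kernel (Suc s) z q (vec_of_chain s a) (vec_of_chain s b) * Phi (Suc s) z q (vec_of_chain s b)
      = gauss_binom q (a s) (b s) * ?Q (b s) * prod Z {..<s} * prod P {..<s}
        * (\<Prod>i<s. q ^ (b (Suc i) * (b (Suc i) - b i)))
        * ((\<Prod>i<s. gauss_binom q (a (Suc i) - b i) (a (Suc i) - a i))
          * (\<Prod>i<s. 1 / ?Q (b (Suc i) - b i)))"
    unfolding Kernel_vec_of_chain[OF q a0 monoa b] Phi_vec_of_chain[where b = b, OF q nz b0 monob]
      prod.distrib prod_gauss_binom_chain[where b = b, OF q b0 monob] q_prod Z_def P_def
    by (simp only: ac_simps)
  also have "\<dots> = (gauss_binom q (a s) (b s) * ?Q (b s) * ?Q (a s - b s))
      * (\<Prod>i<s. 1 / ?Q (a (Suc i) - a i)) * (\<Prod>i<s. Z i * q ^ (b (Suc i) * (b (Suc i) - b i))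
            * gauss_binom q (a (Suc i) - b i) (b (Suc i) - b i) * P i)"
    unfolding binoms prod.distrib by (simp only: ac_simps)
  finally show ?thesis
    unfolding outer by (simp add: Z_def P_def)
qed

lemma sum_summands_vec_of_chain:
  assumes q: "norm q < 1" and nz: "\<forall>i\<in>{1..s}. \<forall>k\<ge>1. z i * q ^ k \<noteq> 1"
    and a0: "a 0 = 0" and mono: "\<forall>i<s. a i \<le> a (Suc i)"
  shows "(\<Sum>b\<in>bounded_chains a s. Kernel (Suc s) z q (vec_of_chain s a) (vec_of_chain s b)
            * Phi (Suc s) z q (vec_of_chain s b)) = Phi (Suc s) z q (vec_of_chain s a)"
proof -
  define C where "C = qpoch_fin q q (a s) * (\<Prod>i<s. 1 / qpoch_fin q q (a (Suc i) - a i))"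
  have "(\<Sum>b\<in>bounded_chains a s. Kernel (Suc s) z q (vec_of_chain s a) (vec_of_chain s b)
            * Phi (Suc s) z q (vec_of_chain s b))
      = C * (\<Sum>b\<in>bounded_chains a s. \<Prod>i<s. z (Suc i) ^ (b (Suc i) - b i)
            * q ^ (b (Suc i) * (b (Suc i) - b i))
            * gauss_binom q (a (Suc i) - b i) (b (Suc i) - b i)
            / qpoch_fin (z (Suc i) * q) q (b (Suc i)))"
    unfolding sum_distrib_left C_def
    by (intro sum.cong refl summand_vec_of_chain[OF q nz a0 mono])
  also have "\<dots> = C * (\<Prod>i<s. 1 / qpoch_fin (z (Suc i) * q) q (a (Suc i)))"
  proof (subst sum_bounded_chains_factor)
    fix i x assume "i < s" "x \<le> a i"
    then show "(\<Sum>y = x..a (Suc i). z (Suc i) ^ (y - x) * q ^ (y * (y - x))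
          * gauss_binom q (a (Suc i) - x) (y - x) / qpoch_fin (z (Suc i) * q) q y)
        = 1 / qpoch_fin (z (Suc i) * q) q (a (Suc i))"
      using mono nz by (intro finite_Cauchy_identity_shifted[OF q]) (auto intro: order_trans)
  qed simp
  \<comment> \<open>\<open>C\<close> is the q-multinomial coefficient of the increments of
    \<open>a\<close>, that is, the product of the Gaussian binomials in \<Phi>.\<close>
  also have "\<dots> = Phi (Suc s) z q (vec_of_chain s a)"
    unfolding Phi_vec_of_chain[where b = a and z = z, OF q nz a0 mono] prod.distrib
      prod_gauss_binom_chain[where b = a, OF q a0 mono] C_def
    by (simp only: ac_simps)
  finally show ?thesis .
qed

section \<open>Vanishing terms and the passage from vectors to chains\<close>

lemma Phi_eq_0:
  assumes "i \<in> {1..r - 1}" "n i < n (Suc i)"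
  shows "Phi r z q n = 0"
  unfolding Phi_def by (rule prod_zero) (use assms in \<open>auto simp: qbinom_def intro!: bexI[of _ i]\<close>)

text \<open>The lower index of the i-th binomial is negative in the first case and exceeds the upper
  one in the second. In chain terms the second case is a_(i-1) < b_(i-1).\<close>

lemma Kernel_eq_0:
  assumes "i \<in> {1..r - 1}"
    and "n i < n (Suc i) \<or> n 1 + m i < n i + m 1"
  shows "Kernel r z q n m = 0"
  unfolding Kernel_def using assms
  by (auto simp: qbinom_def intro!: prod_zero bexI[of _ i])

text \<open>This covers a_s < b_s, the one violated bound that the factors 1, ..., s do not
  detect.\<close>

lemma Kernel_eq_0_head: "n 1 < m 1 \<Longrightarrow> Kernel r z q n m = 0"
  by (simp add: Kernel_def qbinom_def)

text \<open>The truncated subtraction is exact on weakly decreasing vectors, the only ones to which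
  the correspondence is applied.\<close>

definition chain_of_vec :: "nat \<Rightarrow> (nat \<Rightarrow> nat) \<Rightarrow> nat \<Rightarrow> nat" where
  "chain_of_vec s n = (\<lambda>i. if i \<le> s then n 1 - n (Suc i) else 0)"

lemma decreasing_le_head:
  fixes n :: "nat \<Rightarrow> nat"
  assumes "\<forall>i\<in>{1..s}. n (Suc i) \<le> n i" "i \<le> s"
  shows "n (Suc i) \<le> n 1"
  using assms(2) by (induction i) (use assms(1) in \<open>force\<close>)+

lemma chain_of_vec_mono:
  assumes "\<forall>i\<in>{1..s}. n (Suc i) \<le> n i"
  shows "chain_of_vec s n 0 = 0" "\<forall>i<s. chain_of_vec s n i \<le> chain_of_vec s n (Suc i)"
  using assms by (auto simp: chain_of_vec_def intro!: diff_le_mono2)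

lemma vec_of_chain_of_vec:
  assumes "n \<in> nat_vecs (Suc s)" "\<forall>i\<in>{1..s}. n (Suc i) \<le> n i"
  shows "vec_of_chain s (chain_of_vec s n) = n"
proof
  fix i
  show "vec_of_chain s (chain_of_vec s n) i = n i"
  proof (cases "i \<in> {1..s}")
    case True
    then obtain j where "i = Suc j" "j < s" by (cases i) auto
    moreover have "n (Suc s) = 0"
      using assms(1) by (auto simp: nat_vecs_def)
    ultimately show ?thesis
      using decreasing_le_head[OF assms(2), of j] by (simp add: vec_of_chain_def chain_of_vec_def)
  qed (use assms(1) in \<open>auto simp: vec_of_chain_def nat_vecs_def\<close>)
qed

lemma chain_of_vec_of_chain:
  assumes "b \<in> bounded_chains a s"
  shows "chain_of_vec s (vec_of_chain s b) = b"
proof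
  fix i
  have b: "b 0 = 0" "\<forall>i<s. b i \<le> b (Suc i)" "\<forall>i>s. b i = 0"
    using assms by (auto simp: bounded_chains_def)
  show "chain_of_vec s (vec_of_chain s b) i = b i"
    using b vec_of_chain_Suc[of 0 s b] vec_of_chain_Suc[of i s b] chain_le[OF b(2), of i s]
    by (cases "i \<le> s") (auto simp: chain_of_vec_def)
qed

text \<open>Only vectors coming from chains bounded by that of \<open>n\<close> contribute, so the
  sum over the infinite index set reduces to a finite sum already evaluated.\<close>

theorem theorem8p2:
  fixes r :: nat and q :: complex and z :: "nat \<Rightarrow> complex" and n :: "nat \<Rightarrow> nat"
  assumes "r \<ge> 2"
    and "q \<noteq> 0" and "norm q < 1"
    and "\<And>i k. i \<in> {1..r - 1} \<Longrightarrow> k \<ge> 1 \<Longrightarrow> z i * q ^ k \<noteq> 1"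
    and "n \<in> nat_vecs r"
  shows "((\<lambda>m. Kernel r z q n m * Phi r z q m) has_sum Phi r z q n) (nat_vecs r)"
proof (cases "\<forall>i\<in>{1..r - 1}. n (Suc i) \<le> n i")
  \<comment> \<open>If \<open>n\<close> increases somewhere, then \<Phi> at \<open>n\<close> and
    every kernel entry in its row vanish.\<close>
  case False
  then obtain i where "i \<in> {1..r - 1}" "n i < n (Suc i)" by force
  then show ?thesis
    by (simp add: Phi_eq_0 Kernel_eq_0)
next
  case dec: True
  obtain s where r: "r = Suc s"
    using \<open>r \<ge> 2\<close> by (cases r) auto
  have nz: "\<forall>i\<in>{1..s}. \<forall>k\<ge>1. z i * q ^ k \<noteq> 1"
    using assms(4) r by simp
  have dec': "\<forall>i\<in>{1..s}. n (Suc i) \<le> n i"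
    using dec r by simp
  define a where "a = chain_of_vec s n"
  note a = chain_of_vec_mono[OF dec', folded a_def]
  have n: "n = vec_of_chain s a"
    using vec_of_chain_of_vec[OF _ dec'] assms(5) r by (simp add: a_def)
  let ?f = "\<lambda>m. Kernel r z q n m * Phi r z q m"
  show ?thesis
  proof (rule has_sum_finite_neutralI)
    show "finite (vec_of_chain s ` bounded_chains a s)"
      by (simp add: finite_bounded_chains)
    show "vec_of_chain s ` bounded_chains a s \<subseteq> nat_vecs r"
      by (auto simp: vec_of_chain_def nat_vecs_def r)
    have "inj_on (vec_of_chain s) (bounded_chains a s)"
      by (rule inj_on_inverseI[where g = "chain_of_vec s"]) (rule chain_of_vec_of_chain)
    then show "Phi r z q n = sum ?f (vec_of_chain s ` bounded_chains a s)"
      using sum_summands_vec_of_chain[where a = a, OF assms(3) nz a]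
      by (simp add: sum.reindex n r)
    fix m assume m: "m \<in> nat_vecs r - vec_of_chain s ` bounded_chains a s"
    show "?f m = 0"
    proof (cases "\<forall>i\<in>{1..s}. m (Suc i) \<le> m i")
      case False
      then obtain i where "i \<in> {1..s}" "m i < m (Suc i)" by force
      then show ?thesis
        by (simp add: Phi_eq_0 r)
    next
      case decm: True
      define b where "b = chain_of_vec s m"
      have "m = vec_of_chain s b"
        using vec_of_chain_of_vec[OF _ decm] m r by (simp add: b_def)
      \<comment> \<open>\<open>b\<close> is monotone and correctly padded, so it can only fail some
        bound b_i \<le> a_i.\<close>
      then have "b \<notin> bounded_chains a s"
        using m by auto
      moreover have "\<forall>i>s. b i = 0"
        by (simp add: b_def chain_of_vec_def)
      ultimately obtain i where "i \<le> s" "a i < b i"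
        using chain_of_vec_mono[OF decm] by (auto simp: bounded_chains_def b_def not_le)
      then have lt: "n 1 - n (Suc i) < m 1 - m (Suc i)"
        by (simp add: a_def b_def chain_of_vec_def)
      then have "i \<noteq> 0"
        by (metis One_nat_def diff_self_eq_0 less_irrefl)
      have "Kernel r z q n m = 0"
      \<comment> \<open>A violation at i = s means n_1 < m_1 and kills the head binomial; one at i <
        s kills the factor with index i + 1.\<close>
      proof (cases "i = s")
        case True
        moreover have "n (Suc s) = 0"
          using assms(5) r by (auto simp: nat_vecs_def)
        ultimately show ?thesis
          using lt by (intro Kernel_eq_0_head) auto
      next
        case False
        then have i: "Suc i \<in> {1..r - 1}"
          using \<open>i \<le> s\<close> r by simp
        have "n (Suc i) \<le> n 1"
          using decreasing_le_head[OF dec' \<open>i \<le> s\<close>] .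
        then show ?thesis
          using lt by (intro Kernel_eq_0[OF i]) linarith
      qed
      then show ?thesis by simp
    qed
  qed
qed

end
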